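(* Let $G$ be a countable discrete group with a proper right-invariant metric $\rho$, and let $V\subseteq\partial G$ be a closed set with uniformly quasi-subadditive horofunctions and no lower bound for its horofunctions. Let $\pi\colon X\to Y$ be a factor map between topological dynamical systems $(X,T,G)$ and $(Y,T,G)$ that is not bounded-to-one. Then for every $\varepsilon>0$, the sets $\mathrm{ND}_{\varepsilon,\pi}(X)\cap V$ and $\mathrm{ND}_\pi(X)\cap V$ are closed.
   Context: A metric $\rho$ on $G$ is right-invariant if $\rho(gf,kf)=\rho(g,k)$ for all $g,k,f\in G$, and proper if every closed ball is finite. For $g\in G$ let $b_g\colon G\to\mathbb{R}$, $b_g(x)=\rho(g,x)-\rho(g,1_G)$. The border $\partial G$ is the set of functions $h\colon G\to\mathbb{R}$ for which there is a sequence $(g_n)$ in $G$ eventually leaving every finite subset of $G$ such that $b_{g_n}\to h$ pointwise; it carries the topology of pointwise convergence. Elements of $\partial G$ are called horofunctions, and the horoball of $h$ is $\{h<0\}=\{x\in G: h(x)<0\}$. $V$ has uniformly quasi-subadditive horofunctions if there is $R>0$ such that $h(gg')\le h(g)+h(g')+R$ for all $h\in V$ and all $g,g'\in G$. $V$ has no lower bound for its horofunctions if $\inf_{g\in G}h(g)=-\infty$ for every $h\in V$. A topological dynamical system $(X,T,G)$ is a compact metric space $(X,d)$ with a continuous action $T$ of $G$, written $T^g\colon X\to X$, with $T^{1_G}=\mathrm{id}_X$ and $T^{g}\circ T^{g'}=T^{gg'}$. A factor map is a continuous surjection commuting with the actions; it is bounded-to-one if there is $M$ such that every fiber has at most $M$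 points. $\mathrm{ND}_{\varepsilon,\pi}(X)$ is the set of $h\in\partial G$ for which there are distinct $x,y\in X$ with $\pi(x)=\pi(y)$ and $d(T^gx,T^gy)\le\varepsilon$ for all $g\in\{h<0\}$; $\mathrm{ND}_\pi(X)=\bigcap_{\varepsilon>0}\mathrm{ND}_{\varepsilon,\pi}(X)$. *)

theory Defs
  imports "HOL-Analysis.Analysis" "HOL-Algebra.Group"
begin

definition right_invariant_metric :: "('g, 'm) monoid_scheme \<Rightarrow> ('g \<Rightarrow> 'g \<Rightarrow> real) \<Rightarrow> bool" where
  "right_invariant_metric G \<rho> \<longleftrightarrow>
     Metric_space (carrier G) \<rho> \<and>
     (\<forall>g\<in>carrier G. \<forall>k\<in>carrier G. \<forall>f\<in>carrier G. \<rho> (g \<otimes>\<^bsub>G\<^esub> f) (k \<otimes>\<^bsub>G\<^esub> f) = \<rho> g k)"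

definition proper_metric :: "'g set \<Rightarrow> ('g \<Rightarrow> 'g \<Rightarrow> real) \<Rightarrow> bool" where
  "proper_metric S \<rho> \<longleftrightarrow> (\<forall>x\<in>S. \<forall>r. finite (Metric_space.mcball S \<rho> x r))"

(* Functions on the group are represented by functions that are undefined outside the
   carrier, so that equality of functions agrees with equality on the carrier. *)

definition busemann :: "('g, 'm) monoid_scheme \<Rightarrow> ('g \<Rightarrow> 'g \<Rightarrow> real) \<Rightarrow> 'g \<Rightarrow> 'g \<Rightarrow> real" where
  "busemann G \<rho> g = (\<lambda>x\<in>carrier G. \<rho> g x - \<rho> g \<one>\<^bsub>G\<^esub>)"

definition border :: "('g, 'm) monoid_scheme \<Rightarrow> ('g \<Rightarrow> 'g \<Rightarrow> real) \<Rightarrow> ('g \<Rightarrow> real) set" where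
  "border G \<rho> = {h \<in> extensional (carrier G).
     \<exists>s. range s \<subseteq> carrier G \<and>
         (\<forall>F. finite F \<longrightarrow> F \<subseteq> carrier G \<longrightarrow> (\<forall>\<^sub>F n in sequentially. s n \<notin> F)) \<and>
         (\<forall>x\<in>carrier G. (\<lambda>n. busemann G \<rho> (s n) x) \<longlonglongrightarrow> h x)}"

definition border_topology ::
    "('g, 'm) monoid_scheme \<Rightarrow> ('g \<Rightarrow> 'g \<Rightarrow> real) \<Rightarrow> ('g \<Rightarrow> real) topology" where
  "border_topology G \<rho> =
     subtopology (product_topology (\<lambda>_. euclideanreal) (carrier G)) (border G \<rho>)"

definition horoball :: "('g, 'm) monoid_scheme \<Rightarrow> ('g \<Rightarrow> real) \<Rightarrow> 'g set" where
  "horoball G h = {x \<in> carrier G. h x < 0}"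

definition uniformly_quasi_subadditive ::
    "('g, 'm) monoid_scheme \<Rightarrow> ('g \<Rightarrow> real) set \<Rightarrow> bool" where
  "uniformly_quasi_subadditive G V \<longleftrightarrow>
     (\<exists>R>0. \<forall>h\<in>V. \<forall>g\<in>carrier G. \<forall>g'\<in>carrier G. h (g \<otimes>\<^bsub>G\<^esub> g') \<le> h g + h g' + R)"

definition no_lower_bound :: "('g, 'm) monoid_scheme \<Rightarrow> ('g \<Rightarrow> real) set \<Rightarrow> bool" where
  "no_lower_bound G V \<longleftrightarrow> (\<forall>h\<in>V. (INF g\<in>carrier G. ereal (h g)) = -\<infinity>)"

definition dynamical_system ::
    "('g, 'm) monoid_scheme \<Rightarrow> 'x set \<Rightarrow> ('x \<Rightarrow> 'x \<Rightarrow> real) \<Rightarrow> ('g \<Rightarrow> 'x \<Rightarrow> 'x) \<Rightarrow> bool" where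
  "dynamical_system G X d T \<longleftrightarrow>
     Metric_space X d \<and>
     compact_space (Metric_space.mtopology X d) \<and>
     continuous_map
       (prod_topology (discrete_topology (carrier G)) (Metric_space.mtopology X d))
       (Metric_space.mtopology X d) (\<lambda>(g, x). T g x) \<and>
     (\<forall>x\<in>X. T \<one>\<^bsub>G\<^esub> x = x) \<and>
     (\<forall>g\<in>carrier G. \<forall>g'\<in>carrier G. \<forall>x\<in>X. T g (T g' x) = T (g \<otimes>\<^bsub>G\<^esub> g') x)"

definition factor_map ::
    "('g, 'm) monoid_scheme \<Rightarrow> 'x set \<Rightarrow> ('x \<Rightarrow> 'x \<Rightarrow> real) \<Rightarrow> ('g \<Rightarrow> 'x \<Rightarrow> 'x) \<Rightarrow>
     'y set \<Rightarrow> ('y \<Rightarrow> 'y \<Rightarrow> real) \<Rightarrow> ('g \<Rightarrow> 'y \<Rightarrow> 'y) \<Rightarrow> ('x \<Rightarrow> 'y) \<Rightarrow> bool" where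
  "factor_map G X d T Y d' S \<pi> \<longleftrightarrow>
     continuous_map (Metric_space.mtopology X d) (Metric_space.mtopology Y d') \<pi> \<and>
     \<pi> ` X = Y \<and>
     (\<forall>g\<in>carrier G. \<forall>x\<in>X. \<pi> (T g x) = S g (\<pi> x))"

definition bounded_to_one :: "'x set \<Rightarrow> 'y set \<Rightarrow> ('x \<Rightarrow> 'y) \<Rightarrow> bool" where
  "bounded_to_one X Y \<pi> \<longleftrightarrow>
     (\<exists>M::nat. \<forall>y\<in>Y. finite {x \<in> X. \<pi> x = y} \<and> card {x \<in> X. \<pi> x = y} \<le> M)"

definition ND_eps ::
    "('g, 'm) monoid_scheme \<Rightarrow> ('g \<Rightarrow> 'g \<Rightarrow> real) \<Rightarrow> 'x set \<Rightarrow> ('x \<Rightarrow> 'x \<Rightarrow> real) \<Rightarrow>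
     ('g \<Rightarrow> 'x \<Rightarrow> 'x) \<Rightarrow> ('x \<Rightarrow> 'y) \<Rightarrow> real \<Rightarrow> ('g \<Rightarrow> real) set" where
  "ND_eps G \<rho> X d T \<pi> \<epsilon> = {h \<in> border G \<rho>.
     \<exists>x\<in>X. \<exists>y\<in>X. x \<noteq> y \<and> \<pi> x = \<pi> y \<and> (\<forall>g\<in>horoball G h. d (T g x) (T g y) \<le> \<epsilon>)}"

definition ND ::
    "('g, 'm) monoid_scheme \<Rightarrow> ('g \<Rightarrow> 'g \<Rightarrow> real) \<Rightarrow> 'x set \<Rightarrow> ('x \<Rightarrow> 'x \<Rightarrow> real) \<Rightarrow>
     ('g \<Rightarrow> 'x \<Rightarrow> 'x) \<Rightarrow> ('x \<Rightarrow> 'y) \<Rightarrow> ('g \<Rightarrow> real) set" where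
  "ND G \<rho> X d T \<pi> = (\<Inter>\<epsilon>\<in>{0<..}. ND_eps G \<rho> X d T \<pi> \<epsilon>)"

end

theory Submission
  imports Defs
begin

text \<open>
  If some pair of distinct points in one fibre is never separated by more than \<open>\<epsilon>\<close>, then
  \<open>ND\<^sub>\<epsilon>\<close> is the whole border. Otherwise every pair that is \<open>\<epsilon>\<close>-close along \<open>{h < 0}\<close> is
  separated by more than \<open>\<epsilon>\<close> at some group element; moving the pair by an element \<open>f\<close> at
  which this happens with \<open>h f\<close> almost minimal produces, by quasi-subadditivity, a pair at distance
  at least \<open>\<epsilon>\<close> that stays \<open>\<epsilon>\<close>-close along \<open>{h < - R - 1}\<close>. Conversely, moving such a pair
  by an element with very negative \<open>h\<close>-value makes it \<open>\<epsilon>\<close>-close along \<open>{h < 0}\<close>. Pairs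
  at distance at least \<open>\<epsilon>\<close> form a compact set, so \<open>ND\<^sub>\<epsilon>\<close> is the projection of a closed set along
  a compact factor.
\<close>

lemma dynamical_system_continuous_map:
  assumes "dynamical_system G X d T" and "g \<in> carrier G"
  shows "continuous_map (Metric_space.mtopology X d) (Metric_space.mtopology X d) (T g)"
proof -
  let ?M = "Metric_space.mtopology X d"
  have "continuous_map ?M (prod_topology (discrete_topology (carrier G)) ?M) (\<lambda>x. (g, x))"
    using assms(2) by (simp add: continuous_map_pairwise o_def)
  moreover have "continuous_map (prod_topology (discrete_topology (carrier G)) ?M) ?M (\<lambda>(g, x). T g x)"
    using assms(1) by (simp add: dynamical_system_def)
  ultimately have "continuous_map ?M ?M ((\<lambda>(g, x). T g x) \<circ> (\<lambda>x. (g, x)))"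
    by (rule continuous_map_compose)
  then show ?thesis
    by (simp add: o_def)
qed

lemma dynamical_system_in_space:
  assumes "dynamical_system G X d T" and "g \<in> carrier G" and "x \<in> X"
  shows "T g x \<in> X"
proof -
  have "Metric_space X d"
    using assms(1) by (simp add: dynamical_system_def)
  then show ?thesis
    using continuous_map_image_subset_topspace[OF dynamical_system_continuous_map[OF assms(1,2)]]
      assms(3) by (auto simp: Metric_space.topspace_mtopology)
qed

lemma dynamical_system_inj_on:
  assumes "group G" and "dynamical_system G X d T" and "g \<in> carrier G"
  shows "inj_on (T g) X"
proof (rule inj_on_inverseI)
  fix x assume "x \<in> X"
  interpret group G by fact
  have "T (inv\<^bsub>G\<^esub> g) (T g x) = T (inv\<^bsub>G\<^esub> g \<otimes>\<^bsub>G\<^esub> g) x"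
    using assms \<open>x \<in> X\<close> by (simp add: dynamical_system_def)
  also have "\<dots> = x"
    using assms \<open>x \<in> X\<close> by (simp add: dynamical_system_def)
  finally show "T (inv\<^bsub>G\<^esub> g) (T g x) = x" .
qed

text \<open>The infimum of \<open>f\<close> over \<open>A\<close> need not be attained, so a slack
  \<delta> is allowed. Below it is used with \<delta> = 1, which is the source of the 1 in the
  threshold \<open>- R - 1\<close>.\<close>

lemma almost_minimal_element:
  fixes f :: "'a \<Rightarrow> real"
  assumes "A \<noteq> {}" and "bdd_below (f ` A)" and "0 < \<delta>"
  obtains a where "a \<in> A" "\<And>b. b \<in> A \<Longrightarrow> f a < f b + \<delta>"
proof -
  have "(INF a\<in>A. f a) < (INF a\<in>A. f a) + \<delta>"
    using assms(3) by simp
  then obtain a where "a \<in> A" "f a < (INF a\<in>A. f a) + \<delta>"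
    by (subst (asm) cINF_less_iff[OF assms(1,2)]) blast
  moreover have "(INF a\<in>A. f a) \<le> f b" if "b \<in> A" for b
    using that assms(2) by (simp add: cINF_lower)
  ultimately show thesis
    using that by fastforce
qed

text \<open>The pair in the conclusion is bounded away from the diagonal by \<epsilon>, whatever
  \<open>h\<close> is, so limits of such pairs remain pairs of distinct points. The price is that
  closeness is kept only on a deeper sublevel set of \<open>h\<close>.\<close>

lemma separated_pair_exists:
  assumes "group G" and "dynamical_system G X d T" and "factor_map G X d T Y d' S \<pi>"
    and sub: "\<And>g g'. g \<in> carrier G \<Longrightarrow> g' \<in> carrier G \<Longrightarrow> h (g \<otimes>\<^bsub>G\<^esub> g') \<le> h g + h g' + R"
    and xy: "x \<in> X" "y \<in> X" "\<pi> x = \<pi> y"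
    and close: "\<And>g. g \<in> horoball G h \<Longrightarrow> d (T g x) (T g y) \<le> \<epsilon>"
    and separated: "\<exists>g\<in>carrier G. \<epsilon> < d (T g x) (T g y)"
  shows "\<exists>u\<in>X. \<exists>v\<in>X. \<pi> u = \<pi> v \<and> \<epsilon> \<le> d u v \<and>
           (\<forall>g\<in>carrier G. - R - 1 \<le> h g \<or> d (T g u) (T g v) \<le> \<epsilon>)"
proof -
  interpret group G by fact
  define A where "A = {g \<in> carrier G. \<epsilon> < d (T g x) (T g y)}"
  have "A \<noteq> {}"
    using separated by (auto simp: A_def)
  \<comment> \<open>The pair is \<epsilon>-close on all of {h < 0}, so every element that separates
    it has nonnegative \<open>h\<close>-value; this is the lower bound that minimising over
    \<open>A\<close> requires.\<close>
  moreover have "0 \<le> h g" if "g \<in> A" for g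
    using close[of g] that by (fastforce simp: A_def horoball_def)
  then have "bdd_below (h ` A)"
    by (auto simp: bdd_below_def)
  ultimately obtain f where f: "f \<in> A" "\<And>g. g \<in> A \<Longrightarrow> h f < h g + 1"
    using almost_minimal_element[of A h 1] zero_less_one by blast
  then have fG: "f \<in> carrier G"
    by (simp add: A_def)
  have "- R - 1 \<le> h g \<or> d (T g (T f x)) (T g (T f y)) \<le> \<epsilon>" if g: "g \<in> carrier G" for g
  proof (rule ccontr)
    assume contra: "\<not> ?thesis"
    have "T g (T f x) = T (g \<otimes>\<^bsub>G\<^esub> f) x" "T g (T f y) = T (g \<otimes>\<^bsub>G\<^esub> f) y"
      using assms(2) g fG xy by (simp_all add: dynamical_system_def)
    \<comment> \<open>An element \<open>g\<close> with \<open>h g < - R - 1\<close> that separates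
      the moved pair would put the product of \<open>g\<close> and \<open>f\<close> into
      \<open>A\<close> with value at most \<open>h g + h f + R < h f - 1\<close>, against the choice
      of \<open>f\<close>.\<close>
    with contra g fG have "g \<otimes>\<^bsub>G\<^esub> f \<in> A"
      by (simp add: A_def)
    from f(2)[OF this] sub[OF g fG] contra show False
      by linarith
  qed
  moreover have "T f x \<in> X" "T f y \<in> X"
    using assms(2) fG xy by (auto intro: dynamical_system_in_space)
  moreover have "\<pi> (T f x) = \<pi> (T f y)"
    using assms(3) fG xy by (simp add: factor_map_def)
  moreover have "\<epsilon> \<le> d (T f x) (T f y)"
    using f(1) by (simp add: A_def)
  ultimately show ?thesis
    by blast
qed

text \<open>The level \<open>c\<close> may be any real number: moving the pair by \<open>k\<close>
  turns closeness below level \<open>c\<close> into closeness below level 0 as soon as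
  \<open>h k < c - R\<close>.\<close>

lemma ND_eps_memI:
  assumes "group G" and "dynamical_system G X d T" and "factor_map G X d T Y d' S \<pi>"
    and "h \<in> border G \<rho>"
    and sub: "\<And>g g'. g \<in> carrier G \<Longrightarrow> g' \<in> carrier G \<Longrightarrow> h (g \<otimes>\<^bsub>G\<^esub> g') \<le> h g + h g' + R"
    and unbounded: "(INF g\<in>carrier G. ereal (h g)) = -\<infinity>"
    and uv: "u \<in> X" "v \<in> X" "\<pi> u = \<pi> v" "u \<noteq> v"
    and close: "\<And>g. g \<in> carrier G \<Longrightarrow> h g < c \<Longrightarrow> d (T g u) (T g v) \<le> \<epsilon>"
  shows "h \<in> ND_eps G \<rho> X d T \<pi> \<epsilon>"
proof -
  interpret group G by fact
  have "(INF g\<in>carrier G. ereal (h g)) < ereal (c - R)"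
    using unbounded by simp
  then obtain k where k: "k \<in> carrier G" "h k < c - R"
    by (auto simp: INF_less_iff)
  have "d (T g (T k u)) (T g (T k v)) \<le> \<epsilon>" if "g \<in> horoball G h" for g
  proof -
    from that have g: "g \<in> carrier G" "h g < 0"
      by (simp_all add: horoball_def)
    have "h (g \<otimes>\<^bsub>G\<^esub> k) < c"
      using sub[OF g(1) k(1)] g(2) k(2) by linarith
    then have "d (T (g \<otimes>\<^bsub>G\<^esub> k) u) (T (g \<otimes>\<^bsub>G\<^esub> k) v) \<le> \<epsilon>"
      using close g(1) k(1) by blast
    then show ?thesis
      using assms(2) g(1) k(1) uv by (simp add: dynamical_system_def)
  qed
  moreover have "T k u \<in> X" "T k v \<in> X"
    using assms(2) k(1) uv by (auto intro: dynamical_system_in_space)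
  moreover have "T k u \<noteq> T k v"
    using dynamical_system_inj_on[OF assms(1,2) k(1)] uv by (auto dest: inj_onD)
  moreover have "\<pi> (T k u) = \<pi> (T k v)"
    using assms(3) k(1) uv by (simp add: factor_map_def)
  ultimately show ?thesis
    unfolding ND_eps_def using assms(4) by blast
qed

text \<open>Each constraint on a triple (h, u, v) is a non-strict inequality or an equality between
  continuous functions, or a union of two such inequalities, and the existential quantifiers over
  \<open>u\<close> and \<open>v\<close> amount to projecting along a compact space.\<close>

lemma closedin_projection_separated_pairs:
  fixes c \<epsilon> :: real
  assumes "dynamical_system G X d T" and "dynamical_system G Y d' S"
    and "factor_map G X d T Y d' S \<pi>"
  shows "closedin (border_topology G \<rho>)
           {h \<in> border G \<rho>. \<exists>u\<in>X. \<exists>v\<in>X. \<pi> u = \<pi> v \<and> \<epsilon> \<le> d u v \<and>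
              (\<forall>g\<in>carrier G. c \<le> h g \<or> d (T g u) (T g v) \<le> \<epsilon>)}"
proof -
  let ?B = "border_topology G \<rho>" and ?M = "Metric_space.mtopology X d"
    and ?N = "Metric_space.mtopology Y d'"
  let ?P = "prod_topology ?B (prod_topology ?M ?M)"
  interpret X: Metric_space X d
    using assms(1) by (simp add: dynamical_system_def)
  interpret Y: Metric_space Y d'
    using assms(2) by (simp add: dynamical_system_def)
  have compact: "compact_space (prod_topology ?M ?M)"
    using assms(1) by (simp add: dynamical_system_def compact_space_prod_topology)
  have topB: "topspace ?B = border G \<rho>"
    by (auto simp: border_topology_def border_def PiE_def)
  have u: "continuous_map ?P ?M (\<lambda>p. fst (snd p))" and v: "continuous_map ?P ?M (\<lambda>p. snd (snd p))"
    using continuous_map_compose[OF continuous_map_snd continuous_map_fst, of ?B ?M ?M]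
      continuous_map_compose[OF continuous_map_snd continuous_map_snd, of ?B ?M ?M]
    by (simp_all add: o_def)
  have coord: "continuous_map ?P euclideanreal (\<lambda>p. fst p g)" if "g \<in> carrier G" for g
  proof -
    have "continuous_map ?B euclideanreal (\<lambda>h. h g)"
      unfolding border_topology_def
      using that by (intro continuous_map_from_subtopology continuous_map_product_projection)
    with continuous_map_fst have "continuous_map ?P euclideanreal ((\<lambda>h. h g) \<circ> fst)"
      by (rule continuous_map_compose)
    then show ?thesis
      by (simp add: o_def)
  qed
  \<comment> \<open>The map \<open>a\<close> is left general to cover both the identity, for the
    distance of the pair itself, and each \<open>T g\<close>.\<close>
  have dist: "continuous_map ?P euclideanreal (\<lambda>p. d (a (fst (snd p))) (a (snd (snd p))))"
    if "continuous_map ?M ?M a" for a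
    using continuous_map_mdist[where m = "metric (X, d)", of ?P "\<lambda>p. a (fst (snd p))"
        "\<lambda>p. a (snd (snd p))"]
      continuous_map_compose[OF u that] continuous_map_compose[OF v that]
    by (simp add: o_def mtopology_of_def X.mspace_metric X.mdist_metric)
  have fibre: "closedin ?P {p \<in> topspace ?P. \<pi> (fst (snd p)) = \<pi> (snd (snd p))}"
  proof -
    have "continuous_map ?M ?N \<pi>"
      using assms(3) by (simp add: factor_map_def)
    from continuous_map_compose[OF u this] continuous_map_compose[OF v this] show ?thesis
      by (intro closedin_continuous_maps_eq[OF Y.Hausdorff_space_mtopology]) (simp_all add: o_def)
  qed
  have far: "closedin ?P {p \<in> topspace ?P. d (fst (snd p)) (snd (snd p)) \<in> {\<epsilon>..}}"
    using dist[of "\<lambda>x. x"] by (intro closedin_continuous_map_preimage) auto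
  \<comment> \<open>Written as a disjunction, the implication from \<open>h g < c\<close> to
    closeness at \<open>g\<close> is visibly a union of two closed sets.\<close>
  have "closedin ?P {p \<in> topspace ?P. c \<le> fst p g \<or> d (T g (fst (snd p))) (T g (snd (snd p))) \<le> \<epsilon>}"
    if "g \<in> carrier G" for g
  proof -
    have "closedin ?P {p \<in> topspace ?P. fst p g \<in> {c..}}"
      using coord[OF that] by (intro closedin_continuous_map_preimage) auto
    moreover have "closedin ?P
        {p \<in> topspace ?P. d (T g (fst (snd p))) (T g (snd (snd p))) \<in> {..\<epsilon>}}"
      using dist[OF dynamical_system_continuous_map[OF assms(1) that]]
      by (intro closedin_continuous_map_preimage) auto
    ultimately have "closedin ?P ({p \<in> topspace ?P. fst p g \<in> {c..}} \<union>
        {p \<in> topspace ?P. d (T g (fst (snd p))) (T g (snd (snd p))) \<in> {..\<epsilon>}})"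
      by (rule closedin_Un)
    then show ?thesis
      by (rule back_subst[where P = "closedin ?P"]) auto
  qed
  \<comment> \<open>Over an empty carrier the inner intersection is the whole type; intersecting
    with \<open>topspace ?P\<close> keeps the set inside the space.\<close>
  then have near: "closedin ?P (topspace ?P \<inter> (\<Inter>g\<in>carrier G. {p \<in> topspace ?P.
      c \<le> fst p g \<or> d (T g (fst (snd p))) (T g (snd (snd p))) \<le> \<epsilon>}))"
    by (cases "carrier G = {}") (auto intro!: closedin_Int closedin_INT simp del: topspace_prod_topology)
  define K where "K = {(h, u, v). h \<in> border G \<rho> \<and> u \<in> X \<and> v \<in> X \<and> \<pi> u = \<pi> v \<and> \<epsilon> \<le> d u v \<and>
    (\<forall>g\<in>carrier G. c \<le> h g \<or> d (T g u) (T g v) \<le> \<epsilon>)}"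
  have "closedin ?P K"
    by (rule back_subst[where P = "closedin ?P", OF closedin_Int[OF closedin_Int[OF fibre far] near]])
      (auto simp: topB K_def)
  then have "closedin ?B (fst ` K)"
    using closed_map_fst[OF compact, of ?B] unfolding closed_map_def by blast
  moreover have "fst ` K = {h \<in> border G \<rho>. \<exists>u\<in>X. \<exists>v\<in>X. \<pi> u = \<pi> v \<and> \<epsilon> \<le> d u v \<and>
      (\<forall>g\<in>carrier G. c \<le> h g \<or> d (T g u) (T g v) \<le> \<epsilon>)}"
    unfolding K_def image_def by auto
  ultimately show ?thesis
    by simp
qed

lemma closedin_ND_eps_Int:
  assumes "group G" and "closedin (border_topology G \<rho>) V"
    and "uniformly_quasi_subadditive G V" and "no_lower_bound G V"
    and "dynamical_system G X d T" and "dynamical_system G Y d' S"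
    and "factor_map G X d T Y d' S \<pi>" and "0 < \<epsilon>"
  shows "closedin (border_topology G \<rho>) (ND_eps G \<rho> X d T \<pi> \<epsilon> \<inter> V)"
proof (cases "\<exists>x\<in>X. \<exists>y\<in>X. x \<noteq> y \<and> \<pi> x = \<pi> y \<and> (\<forall>g\<in>carrier G. d (T g x) (T g y) \<le> \<epsilon>)")
  case True
  have "V \<subseteq> border G \<rho>"
    using closedin_subset[OF assms(2)] by (auto simp: border_topology_def)
  with True have "ND_eps G \<rho> X d T \<pi> \<epsilon> \<inter> V = V"
    unfolding ND_eps_def horoball_def by blast
  with assms(2) show ?thesis
    by simp
next
  case False
  interpret X: Metric_space X d
    using assms(5) by (simp add: dynamical_system_def)
  obtain R where sub: "\<And>h g g'. h \<in> V \<Longrightarrow> g \<in> carrier G \<Longrightarrow> g' \<in> carrier G \<Longrightarrow>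
      h (g \<otimes>\<^bsub>G\<^esub> g') \<le> h g + h g' + R"
    using assms(3) unfolding uniformly_quasi_subadditive_def by blast
  \<comment> \<open>The constant \<open>R\<close> is the same for all of \<open>V\<close>, so a
    single threshold, and hence a single closed set, serves every horofunction in
    \<open>V\<close>.\<close>
  define C where "C = {h \<in> border G \<rho>. \<exists>u\<in>X. \<exists>v\<in>X. \<pi> u = \<pi> v \<and> \<epsilon> \<le> d u v \<and>
    (\<forall>g\<in>carrier G. - R - 1 \<le> h g \<or> d (T g u) (T g v) \<le> \<epsilon>)}"
  have "ND_eps G \<rho> X d T \<pi> \<epsilon> \<inter> V = C \<inter> V"
  proof (intro equalityI subsetI IntI)
    fix h assume "h \<in> ND_eps G \<rho> X d T \<pi> \<epsilon> \<inter> V"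
    then obtain x y where h: "h \<in> V" "h \<in> border G \<rho>"
      and xy: "x \<in> X" "y \<in> X" "x \<noteq> y" "\<pi> x = \<pi> y"
      and close: "\<And>g. g \<in> horoball G h \<Longrightarrow> d (T g x) (T g y) \<le> \<epsilon>"
      unfolding ND_eps_def by blast
    have "\<exists>g\<in>carrier G. \<epsilon> < d (T g x) (T g y)"
      using False xy by (meson not_le)
    from separated_pair_exists[where h = h, OF assms(1,5,7) sub[OF h(1)] xy(1,2,4) close this] h(2)
    show "h \<in> C"
      by (simp add: C_def)
  next
    fix h assume h: "h \<in> C \<inter> V"
    then obtain u v where uv: "u \<in> X" "v \<in> X" "\<pi> u = \<pi> v" "\<epsilon> \<le> d u v"
      and close: "\<And>g. g \<in> carrier G \<Longrightarrow> - R - 1 \<le> h g \<or> d (T g u) (T g v) \<le> \<epsilon>"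
      unfolding C_def by blast
    have "u \<noteq> v"
      using uv \<open>0 < \<epsilon>\<close> by auto
    moreover have "(INF g\<in>carrier G. ereal (h g)) = -\<infinity>"
      using h assms(4) by (simp add: no_lower_bound_def)
    moreover have "h \<in> V" "h \<in> border G \<rho>"
      using h by (auto simp: C_def)
    ultimately show "h \<in> ND_eps G \<rho> X d T \<pi> \<epsilon>"
      using close uv by (intro ND_eps_memI[where c = "- R - 1", OF assms(1,5,7) _ sub]) fastforce+
  qed auto
  moreover have "closedin (border_topology G \<rho>) C"
    unfolding C_def by (rule closedin_projection_separated_pairs[OF assms(5-7)])
  ultimately show ?thesis
    using assms(2) by (simp add: closedin_Int)
qed

theorem theorem3p2:
  fixes G :: "('g, 'm) monoid_scheme"
    and \<rho> :: "'g \<Rightarrow> 'g \<Rightarrow> real"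
    and V :: "('g \<Rightarrow> real) set"
    and X :: "'x set" and d :: "'x \<Rightarrow> 'x \<Rightarrow> real" and T :: "'g \<Rightarrow> 'x \<Rightarrow> 'x"
    and Y :: "'y set" and d' :: "'y \<Rightarrow> 'y \<Rightarrow> real" and S :: "'g \<Rightarrow> 'y \<Rightarrow> 'y"
    and \<pi> :: "'x \<Rightarrow> 'y"
  assumes "group G" and "countable (carrier G)"
    and "right_invariant_metric G \<rho>" and "proper_metric (carrier G) \<rho>"
    and "closedin (border_topology G \<rho>) V"
    and "uniformly_quasi_subadditive G V" and "no_lower_bound G V"
    and "dynamical_system G X d T" and "dynamical_system G Y d' S"
    and "factor_map G X d T Y d' S \<pi>"
    and "\<not> bounded_to_one X Y \<pi>"
  shows "\<forall>\<epsilon>>0. closedin (border_topology G \<rho>) (ND_eps G \<rho> X d T \<pi> \<epsilon> \<inter> V) \<and>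
               closedin (border_topology G \<rho>) (ND G \<rho> X d T \<pi> \<inter> V)"
proof (intro allI impI conjI)
  have eps: "closedin (border_topology G \<rho>) (ND_eps G \<rho> X d T \<pi> \<epsilon> \<inter> V)" if "0 < \<epsilon>" for \<epsilon>
    using assms(1,5-10) that by (rule closedin_ND_eps_Int)
  then show "closedin (border_topology G \<rho>) (ND_eps G \<rho> X d T \<pi> \<epsilon> \<inter> V)" if "0 < \<epsilon>" for \<epsilon>
    using that .
  \<comment> \<open>Moving the intersection with \<open>V\<close> inside the family uses that there
    is some positive real.\<close>
  have "ND G \<rho> X d T \<pi> \<inter> V = (\<Inter>\<epsilon>\<in>{0<..}. ND_eps G \<rho> X d T \<pi> \<epsilon> \<inter> V)"
    using greaterThan_non_empty[of "0 :: real"] unfolding ND_def by blast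
  moreover have "closedin (border_topology G \<rho>) (\<Inter>\<epsilon>\<in>{0<..}. ND_eps G \<rho> X d T \<pi> \<epsilon> \<inter> V)"
    using eps by (intro closedin_INT) auto
  ultimately show "closedin (border_topology G \<rho>) (ND G \<rho> X d T \<pi> \<inter> V)"
    by simp
qed

end
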